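(* Let $G$ be a group equipped with the basic measure $(\mathcal{B},|\cdot|)$ and let $A\in\mathcal{B}$ be non-empty. Then $|A^n|<|G|$ for all positive integers $n$ if and only if there is a proper finite index subgroup $H$ of $G$ such that $A$ is a subset of a left right coset of $H$.
   Context: The basic measure on a group $G$: $\mathcal{B}$ is the collection consisting of $\emptyset$ and all finite unions of left and right cosets of finite index subgroups of $G$. Each $A\in\mathcal{B}$ is a union of some number $r$ of cosets of a finite index normal subgroup $R$ of $G$, and $|A|=r/[G:R]$ (well defined, finitely additive, $|G|=1$). $A^n=\{a_1a_2\cdots a_n: a_i\in A\}$, which again lies in $\mathcal{B}$ when $A$ does. A left right coset of a subgroup $H$ is a subset which is both a left coset and a right coset of $H$, i.e. a set of the form $gH=Hg$ with $g\in G$. *)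

theory Defs
  imports Complex_Main "HOL-Algebra.Coset"
begin

definition finite_index_subgroup :: "('a, 'b) monoid_scheme \<Rightarrow> 'a set \<Rightarrow> bool" where
  "finite_index_subgroup G H \<longleftrightarrow> subgroup H G \<and> finite (rcosets\<^bsub>G\<^esub> H)"

text \<open>The empty set is included as the union of the empty family. Different cosets in
  the family may belong to different subgroups.\<close>

definition basic_sets :: "('a, 'b) monoid_scheme \<Rightarrow> 'a set set" where
  "basic_sets G = {\<Union>\<C> | \<C>. finite \<C> \<and>
     (\<forall>C\<in>\<C>. \<exists>H. finite_index_subgroup G H \<and>
        (\<exists>g\<in>carrier G. C = g <#\<^bsub>G\<^esub> H \<or> C = H #>\<^bsub>G\<^esub> g))}"

text \<open>For \<open>A\<close> in \<open>basic_sets G\<close> the number \<open>r / [G : R]\<close> exists and does not depend on the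
  normal subgroup \<open>R\<close>; outside \<open>basic_sets G\<close> the value is unspecified.\<close>

definition basic_measure :: "('a, 'b) monoid_scheme \<Rightarrow> 'a set \<Rightarrow> real" where
  "basic_measure G A = (THE x. \<exists>R \<C>. R \<lhd> G \<and> finite_index_subgroup G R \<and>
     \<C> \<subseteq> rcosets\<^bsub>G\<^esub> R \<and> A = \<Union>\<C> \<and>
     x = real (card \<C>) / real (card (rcosets\<^bsub>G\<^esub> R)))"

definition set_power :: "('a, 'b) monoid_scheme \<Rightarrow> 'a set \<Rightarrow> nat \<Rightarrow> 'a set" where
  "set_power G A n = {foldr (mult G) as \<one>\<^bsub>G\<^esub> | as. length as = n \<and> set as \<subseteq> A}"

definition left_right_coset :: "('a, 'b) monoid_scheme \<Rightarrow> 'a set \<Rightarrow> 'a set \<Rightarrow> bool" where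
  "left_right_coset G H C \<longleftrightarrow> (\<exists>g\<in>carrier G. C = g <#\<^bsub>G\<^esub> H \<and> C = H #>\<^bsub>G\<^esub> g)"

end

theory Submission
  imports Defs
begin

text \<open>A basic set \<open>A\<close> is a union of cosets of a normal subgroup \<open>R\<close> of finite index, and so is every
  \<open>A^n\<close>; hence \<open>|A^n| < |G|\<close> just says \<open>A^n \<noteq> G\<close>. If \<open>A \<subseteq> gH = Hg\<close>, then \<open>A^n\<close> lies in
  \<open>Hg^n\<close>. Conversely, choose \<open>n\<close> such that \<open>S = A^n\<close> contains the largest number of \<open>R\<close>-cosets. Since
  translations preserve that number, \<open>bS = A^(n+1) = Sb\<close> for all \<open>b \<in> A\<close>. Let \<open>H\<close> be the stabiliser
  of \<open>S\<close> under left translation. Then \<open>a\<inverse>b \<in> H\<close> for \<open>a, b \<in> A\<close>, and comparing the stabilisers of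
  \<open>aS\<close> and \<open>Sa\<close> gives \<open>aHa\<inverse> = H\<close>. If \<open>H = G\<close>, then \<open>S = G\<close>.\<close>

section \<open>Unions of cosets and the recursion for powers\<close>

text \<open>For a subgroup \<open>R\<close> these are the unions of right cosets of
  \<open>R\<close>. Stated as a closure condition, the property passes easily to smaller subgroups,
  to unions and to products.\<close>

definition coset_saturated :: "('a, 'b) monoid_scheme \<Rightarrow> 'a set \<Rightarrow> 'a set \<Rightarrow> bool" where
  "coset_saturated G R S \<longleftrightarrow> S \<subseteq> carrier G \<and> (\<forall>r\<in>R. \<forall>s\<in>S. r \<otimes>\<^bsub>G\<^esub> s \<in> S)"

text \<open>The number of these cosets becomes the numerator of the measure. The set
  \<open>S\<close> is arbitrary, so that a translate can be counted before it is known to be a union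
  of cosets.\<close>

definition cosets_within :: "('a, 'b) monoid_scheme \<Rightarrow> 'a set \<Rightarrow> 'a set \<Rightarrow> 'a set set" where
  "cosets_within G R S = {D \<in> rcosets\<^bsub>G\<^esub> R. D \<subseteq> S}"

lemma finite_cosets_within: "finite_index_subgroup G R \<Longrightarrow> finite (cosets_within G R S)"
  by (simp add: finite_index_subgroup_def cosets_within_def)

lemma set_power_0: "set_power G A 0 = {\<one>\<^bsub>G\<^esub>}"
  by (auto simp: set_power_def)

lemma set_power_Suc: "set_power G A (Suc n) = A <#>\<^bsub>G\<^esub> set_power G A n"
  unfolding set_power_def set_mult_def
  by (force simp: length_Suc_conv)

context group
begin

section \<open>Subgroups of finite index\<close>

text \<open>The coset \<open>K #> x\<close> depends only on \<open>f x\<close>, so there are at most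
  as many cosets as values of \<open>f\<close>. In the main uses \<open>f\<close> records a coset of
  a smaller subgroup, a pair of cosets, or a permutation of cosets.\<close>

lemma finite_rcosetsI:
  assumes "subgroup K G" and "finite (f ` carrier G)"
    and "\<And>x y. \<lbrakk>x \<in> carrier G; y \<in> carrier G; f x = f y\<rbrakk> \<Longrightarrow> x \<otimes> inv y \<in> K"
  shows "finite (rcosets K)"
proof -
  have eq: "K #> x = K #> y" if "x \<in> carrier G" "y \<in> carrier G" "f x = f y" for x y
    using that assms subgroup.rcos_module[OF assms(1) is_group, of y x]
      repr_independence[of x K y] by auto
  \<comment> \<open>The choice is harmless: by \<open>eq\<close>, all \<open>x\<close> with the
    value \<open>v\<close> give the same coset.\<close>
  define g where "g v = K #> (SOME x. x \<in> carrier G \<and> f x = v)" for v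
  have "K #> x = g (f x)" if "x \<in> carrier G" for x
    unfolding g_def using that by (intro eq) (auto intro: someI2)
  then have "rcosets K \<subseteq> g ` f ` carrier G"
    unfolding RCOSETS_def by auto
  then show ?thesis
    using assms(2) finite_surj by blast
qed

lemma finite_index_subgroup_mono:
  assumes "finite_index_subgroup G R" and "subgroup H G" and "R \<subseteq> H"
  shows "finite_index_subgroup G H"
proof -
  have R: "subgroup R G" using assms(1) by (simp add: finite_index_subgroup_def)
  have "finite (rcosets H)"
  proof (rule finite_rcosetsI[where f = "\<lambda>x. R #> x"])
    have "(\<lambda>x. R #> x) ` carrier G = rcosets R" by (auto simp: RCOSETS_def)
    then show "finite ((\<lambda>x. R #> x) ` carrier G)"
      using assms(1) by (simp add: finite_index_subgroup_def)
    show "x \<otimes> inv y \<in> H" if "x \<in> carrier G" "y \<in> carrier G" "R #> x = R #> y" for x y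
      using that rcos_self[of x R] R assms(3) subgroup.rcos_module_imp[OF R is_group] by blast
  qed (fact assms(2))
  then show ?thesis using assms(2) by (simp add: finite_index_subgroup_def)
qed

lemma finite_index_subgroup_Int:
  assumes "finite_index_subgroup G R1" and "finite_index_subgroup G R2"
  shows "finite_index_subgroup G (R1 \<inter> R2)"
proof -
  have R: "subgroup R1 G" "subgroup R2 G"
    using assms by (auto simp: finite_index_subgroup_def)
  have "finite (rcosets (R1 \<inter> R2))"
  proof (rule finite_rcosetsI[where f = "\<lambda>x. (R1 #> x, R2 #> x)"])
    show "subgroup (R1 \<inter> R2) G" using R by (rule subgroups_Inter_pair)
    have "(\<lambda>x. (R1 #> x, R2 #> x)) ` carrier G \<subseteq> (rcosets R1) \<times> (rcosets R2)"
      by (auto simp: RCOSETS_def)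
    then show "finite ((\<lambda>x. (R1 #> x, R2 #> x)) ` carrier G)"
      by (rule finite_subset) (use assms in \<open>simp add: finite_index_subgroup_def\<close>)
    show "x \<otimes> inv y \<in> R1 \<inter> R2"
      if "x \<in> carrier G" "y \<in> carrier G" "(R1 #> x, R2 #> x) = (R1 #> y, R2 #> y)" for x y
      using that rcos_self[of x R1] rcos_self[of x R2] R
        subgroup.rcos_module_imp[OF R(1) is_group, of y x]
        subgroup.rcos_module_imp[OF R(2) is_group, of y x] by auto
  qed
  then show ?thesis
    using R subgroups_Inter_pair by (simp add: finite_index_subgroup_def)
qed

section \<open>Translation of cosets and normal subgroups of finite index\<close>

lemma rcosets_r_coset:
  assumes "subgroup R G" and "D \<in> rcosets R" and "g \<in> carrier G"
  shows "D #> g \<in> rcosets R" and "D #> g #> inv g = D"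
proof -
  obtain x where x: "x \<in> carrier G" "D = R #> x" using assms(2) by (auto simp: RCOSETS_def)
  have R: "R \<subseteq> carrier G" using assms(1) subgroup.subset by blast
  show "D #> g \<in> rcosets R"
    using x R assms(3) by (simp add: coset_mult_assoc rcosetsI)
  show "D #> g #> inv g = D"
    using x R assms(3) by (simp add: coset_mult_assoc m_assoc)
qed

text \<open>Left translation maps left cosets to left cosets; normality identifies these with the
  right cosets.\<close>

lemma rcosets_l_coset:
  assumes "R \<lhd> G" and "D \<in> rcosets R" and "g \<in> carrier G"
  shows "g <# D \<in> rcosets R" and "inv g <# (g <# D) = D"
proof -
  obtain x where x: "x \<in> carrier G" "D = R #> x" using assms(2) by (auto simp: RCOSETS_def)
  have R: "R \<subseteq> carrier G" using assms(1) normal_imp_subgroup subgroup.subset by blast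
  have D: "D \<subseteq> carrier G" using x R r_coset_subset_G by simp
  have "D = x <# R" using x normal.coset_eq[OF assms(1)] by simp
  then have "g <# D = R #> (g \<otimes> x)"
    using x R assms(3) normal.coset_eq[OF assms(1)] by (simp add: lcos_m_assoc)
  then show "g <# D \<in> rcosets R"
    using x R assms(3) by (simp add: rcosetsI)
  show "inv g <# (g <# D) = D"
    using D assms(3) by (simp add: lcos_m_assoc lcos_mult_one)
qed

text \<open>The kernel of the action of \<open>G\<close> on the right cosets of \<open>H\<close>.\<close>

lemma finite_index_normal_core:
  assumes "finite_index_subgroup G H"
  obtains R where "R \<lhd> G" and "finite_index_subgroup G R" and "R \<subseteq> H"
proof -
  have H: "subgroup H G" and fin: "finite (rcosets H)"
    using assms by (auto simp: finite_index_subgroup_def)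
  define R where "R = {x \<in> carrier G. \<forall>C\<in>rcosets H. C #> x = C}"
  have sub: "C \<subseteq> carrier G" if "C \<in> rcosets H" for C
    using that H subgroup.rcosets_carrier is_group by blast
  have R: "subgroup R G"
  proof (rule subgroupI)
    show "R \<subseteq> carrier G" by (auto simp: R_def)
    have "\<one> \<in> R" using sub by (auto simp: R_def)
    then show "R \<noteq> {}" by blast
    show "inv a \<in> R" if "a \<in> R" for a
      using that rcosets_r_coset(2)[OF H, of _ a] by (force simp: R_def)
    show "a \<otimes> b \<in> R" if "a \<in> R" "b \<in> R" for a b
      using that sub by (auto simp: R_def coset_mult_assoc[symmetric])
  qed
  have normal: "R \<lhd> G"
  proof (rule normal_invI[OF R])
    fix x h assume x: "x \<in> carrier G" and h: "h \<in> R"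
    have "C #> (x \<otimes> h \<otimes> inv x) = C" if C: "C \<in> rcosets H" for C
    proof -
      have "C #> (x \<otimes> h \<otimes> inv x) = C #> x #> h #> inv x"
        using x h sub[OF C] by (simp add: R_def coset_mult_assoc r_coset_subset_G m_assoc)
      also have "C #> x #> h = C #> x"
        using h rcosets_r_coset(1)[OF H C x] by (simp add: R_def)
      also have "C #> x #> inv x = C"
        by (rule rcosets_r_coset(2)[OF H C x])
      finally show ?thesis .
    qed
    then show "x \<otimes> h \<otimes> inv x \<in> R" using x h by (simp add: R_def)
  qed
  \<comment> \<open>Elements that act alike differ by an element of the kernel, so the index is
    bounded by the number of self-maps of the finite set of cosets of \<open>H\<close>. The
    restriction places the action in that finite function space.\<close>
  have "finite (rcosets R)"
  proof (rule finite_rcosetsI[OF R, where f = "\<lambda>x. restrict (\<lambda>C. C #> x) (rcosets H)"])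
    have "(\<lambda>x. restrict (\<lambda>C. C #> x) (rcosets H)) ` carrier G \<subseteq> rcosets H \<rightarrow>\<^sub>E rcosets H"
      using rcosets_r_coset(1)[OF H] by auto
    then show "finite ((\<lambda>x. restrict (\<lambda>C. C #> x) (rcosets H)) ` carrier G)"
      using fin finite_PiE finite_subset by metis
    fix x y assume x: "x \<in> carrier G" and y: "y \<in> carrier G"
      and eq: "restrict (\<lambda>C. C #> x) (rcosets H) = restrict (\<lambda>C. C #> y) (rcosets H)"
    have "C #> (x \<otimes> inv y) = C" if C: "C \<in> rcosets H" for C
    proof -
      have "C #> x = C #> y" using fun_cong[OF eq, of C] C by simp
      then have "C #> x #> inv y = C" using rcosets_r_coset(2)[OF H C y] by simp
      then show ?thesis using x y sub[OF C] by (simp add: coset_mult_assoc)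
    qed
    then show "x \<otimes> inv y \<in> R" using x y by (simp add: R_def)
  qed
  \<comment> \<open>Elements of the kernel fix in particular the coset \<open>H\<close>
    itself.\<close>
  moreover have "R \<subseteq> H"
  proof
    fix x assume "x \<in> R"
    then show "x \<in> H"
      using coset_join1[of H x] subgroup.subgroup_in_rcosets[OF H is_group] H
      by (auto simp: R_def)
  qed
  ultimately show ?thesis using that normal R by (simp add: finite_index_subgroup_def)
qed

section \<open>Basic sets as unions of cosets of one normal subgroup\<close>

text \<open>A coset of \<open>H\<close>, left or right, is closed under left multiplication by any
  normal subgroup inside \<open>H\<close>. Induction over the family intersects the normal subgroups
  found for its members.\<close>

lemma basic_sets_saturated:
  assumes "A \<in> basic_sets G"
  obtains R where "R \<lhd> G" and "finite_index_subgroup G R" and "coset_saturated G R A"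
proof -
  obtain \<C> where \<C>: "finite \<C>" "A = \<Union>\<C>"
    and cosets: "\<forall>C\<in>\<C>. \<exists>H. finite_index_subgroup G H \<and>
        (\<exists>g\<in>carrier G. C = g <# H \<or> C = H #> g)"
    using assms by (auto simp: basic_sets_def)
  have "\<exists>R. R \<lhd> G \<and> finite_index_subgroup G R \<and> coset_saturated G R (\<Union>\<C>)"
    using \<C>(1) cosets
  proof (induction \<C>)
    case empty
    have "carrier G \<lhd> G"
      using subgroup_self by (rule normal_invI) auto
    moreover have "finite (rcosets (carrier G))"
      by (rule finite_rcosetsI[where f = "\<lambda>_. ()"]) (auto simp: subgroup_self)
    ultimately show ?case
      by (auto simp: coset_saturated_def finite_index_subgroup_def subgroup_self)
  next
    case (insert C \<C>)
    then obtain R1 where R1: "R1 \<lhd> G" "finite_index_subgroup G R1" "coset_saturated G R1 (\<Union>\<C>)"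
      by auto
    obtain H g where H: "finite_index_subgroup G H" and g: "g \<in> carrier G"
      and C: "C = g <# H \<or> C = H #> g"
      using insert.prems by auto
    have sub: "subgroup H G" using H by (simp add: finite_index_subgroup_def)
    then have HG: "H \<subseteq> carrier G" by (rule subgroup.subset)
    obtain R2 where R2: "R2 \<lhd> G" "finite_index_subgroup G R2" "R2 \<subseteq> H"
      using finite_index_normal_core[OF H] .
    have "coset_saturated G R2 C"
      unfolding coset_saturated_def
    proof (intro conjI ballI)
      show "C \<subseteq> carrier G"
        using C l_coset_subset_G[OF HG g] r_coset_subset_G[OF HG g] by metis
      fix r s assume r: "r \<in> R2" and s: "s \<in> C"
      have rG: "r \<in> carrier G" and rH: "r \<in> H" using r R2(3) HG by auto
      from C show "r \<otimes> s \<in> C"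
      proof
        assume C: "C = g <# H"
        then obtain h where h: "h \<in> H" "s = g \<otimes> h" using s by (auto simp: l_coset_def)
        \<comment> \<open>To reach \<open>H\<close>, the factor \<open>r\<close> must pass
          \<open>g\<close>; normality keeps its conjugate in \<open>R2\<close>.\<close>
        have "inv g \<otimes> r \<otimes> g \<in> H"
          using normal.inv_op_closed1[OF R2(1) g r] R2(3) by blast
        then have "g \<otimes> (inv g \<otimes> r \<otimes> g \<otimes> h) \<in> C"
          using C h sub by (auto simp: l_coset_def subgroup.m_closed)
        moreover have "g \<otimes> (inv g \<otimes> r \<otimes> g \<otimes> h) = r \<otimes> s"
          using h g rG HG by (simp add: subset_iff m_assoc[symmetric])
        ultimately show ?thesis by simp
      next
        assume C: "C = H #> g"
        then obtain h where h: "h \<in> H" "s = h \<otimes> g" using s by (auto simp: r_coset_def)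
        have "r \<otimes> s = (r \<otimes> h) \<otimes> g" using h g rG HG by (simp add: subset_iff m_assoc)
        then show ?thesis
          using C h rH sub by (auto simp: r_coset_def subgroup.m_closed)
      qed
    qed
    with R1 have "coset_saturated G (R1 \<inter> R2) (\<Union>(insert C \<C>))"
      by (auto simp: coset_saturated_def)
    then show ?case
      using R1 R2 normal_subgroup_intersect finite_index_subgroup_Int by blast
  qed
  then show ?thesis using that \<C>(2) by blast
qed

lemma Union_cosets_within:
  assumes "subgroup R G" and "coset_saturated G R S"
  shows "\<Union>(cosets_within G R S) = S"
proof
  show "\<Union>(cosets_within G R S) \<subseteq> S" by (auto simp: cosets_within_def)
  show "S \<subseteq> \<Union>(cosets_within G R S)"
  proof
    fix s assume s: "s \<in> S"
    then have "R #> s \<in> cosets_within G R S"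
      using assms subgroup.subset[OF assms(1)]
      by (auto simp: cosets_within_def coset_saturated_def r_coset_def RCOSETS_def)
    then show "s \<in> \<Union>(cosets_within G R S)"
      using s assms rcos_self by (auto simp: coset_saturated_def)
  qed
qed

section \<open>Coset counts and the value of the measure\<close>

text \<open>Translation by \<open>g\<close> is injective on cosets. Where the reverse inequality is
  wanted, it comes from translating by the inverse.\<close>

lemma card_cosets_within_r_coset:
  assumes R: "finite_index_subgroup G R" and g: "g \<in> carrier G"
  shows "card (cosets_within G R S) \<le> card (cosets_within G R (S #> g))"
proof (rule card_inj_on_le)
  have sub: "subgroup R G" using R by (simp add: finite_index_subgroup_def)
  show "inj_on (\<lambda>D. D #> g) (cosets_within G R S)"
    using rcosets_r_coset(2)[OF sub _ g]
    by (intro inj_on_inverseI[where g = "\<lambda>D. D #> inv g"]) (auto simp: cosets_within_def)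
  show "(\<lambda>D. D #> g) ` cosets_within G R S \<subseteq> cosets_within G R (S #> g)"
    using rcosets_r_coset(1)[OF sub _ g] by (auto simp: cosets_within_def r_coset_def)
qed (rule finite_cosets_within[OF R])

lemma card_cosets_within_l_coset:
  assumes R: "finite_index_subgroup G R" and "R \<lhd> G" and g: "g \<in> carrier G"
  shows "card (cosets_within G R S) \<le> card (cosets_within G R (g <# S))"
proof (rule card_inj_on_le)
  show "inj_on (\<lambda>D. g <# D) (cosets_within G R S)"
    using rcosets_l_coset(2)[OF assms(2) _ g]
    by (intro inj_on_inverseI[where g = "\<lambda>D. inv g <# D"]) (auto simp: cosets_within_def)
  show "(\<lambda>D. g <# D) ` cosets_within G R S \<subseteq> cosets_within G R (g <# S)"
    using rcosets_l_coset(1)[OF assms(2) _ g] by (auto simp: cosets_within_def l_coset_def)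
qed (rule finite_cosets_within[OF R])

text \<open>By translation all cosets of \<open>R\<close> contain equally many cosets of
  \<open>K\<close>, namely the index of \<open>K\<close> in \<open>R\<close>. Refining the subgroup
  thus multiplies every count by the same constant.\<close>

lemma card_cosets_within_Union:
  assumes K: "finite_index_subgroup G K" and R: "finite_index_subgroup G R"
    and "K \<subseteq> R" and \<C>: "\<C> \<subseteq> rcosets R"
  shows "card (cosets_within G K (\<Union>\<C>)) = card \<C> * card (cosets_within G K R)"
proof -
  have subK: "subgroup K G" and subR: "subgroup R G" and fin: "finite (rcosets R)"
    using K R by (auto simp: finite_index_subgroup_def)
  have one: "card (cosets_within G K C) = card (cosets_within G K R)" if "C \<in> \<C>" for C
  proof -
    have "C \<in> rcosets R" using that \<C> by blast
    then obtain x where x: "x \<in> carrier G" "C = R #> x" by (auto simp: RCOSETS_def)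
    have "C #> inv x = R"
      using x subgroup.subset[OF subR] by (simp add: coset_mult_assoc)
    then have "card (cosets_within G K C) \<le> card (cosets_within G K R)"
      using card_cosets_within_r_coset[OF K, of "inv x" C] x(1) by simp
    moreover have "card (cosets_within G K R) \<le> card (cosets_within G K C)"
      using card_cosets_within_r_coset[OF K, of x R] x by simp
    ultimately show ?thesis by simp
  qed
  \<comment> \<open>A coset of \<open>K\<close> inside the union lies in a single member, the coset
    of \<open>R\<close> through its representative.\<close>
  have "cosets_within G K (\<Union>\<C>) = (\<Union>C\<in>\<C>. cosets_within G K C)"
  proof (intro equalityI subsetI)
    fix D assume D: "D \<in> cosets_within G K (\<Union>\<C>)"
    then obtain x where x: "x \<in> carrier G" "D = K #> x"
      by (auto simp: cosets_within_def RCOSETS_def)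
    then have "x \<in> D" using rcos_self subK by blast
    then obtain C where C: "C \<in> \<C>" "x \<in> C" using D by (auto simp: cosets_within_def)
    then have "C \<in> rcosets R" using \<C> by blast
    then obtain y where y: "y \<in> carrier G" "C = R #> y" by (auto simp: RCOSETS_def)
    then have "C = R #> x" using repr_independence[of x R y] C subR by simp
    then have "D \<subseteq> C" using x \<open>K \<subseteq> R\<close> by (auto simp: r_coset_def)
    then show "D \<in> (\<Union>C\<in>\<C>. cosets_within G K C)"
      using D C by (auto simp: cosets_within_def)
  qed (auto simp: cosets_within_def)
  also have "card \<dots> = (\<Sum>C\<in>\<C>. card (cosets_within G K C))"
  proof (rule card_UN_disjoint)
    show "finite \<C>" using \<C> fin finite_subset by blast
    show "\<forall>C\<in>\<C>. finite (cosets_within G K C)" using finite_cosets_within[OF K] by blast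
    have "C = C'" if "C \<in> \<C>" "C' \<in> \<C>" "D \<in> cosets_within G K C" "D \<in> cosets_within G K C'" for C C' D
    proof (rule ccontr)
      assume "C \<noteq> C'"
      moreover have "C \<in> rcosets R" "C' \<in> rcosets R" using that(1,2) \<C> by auto
      ultimately have "C \<inter> C' = {}"
        using pairwiseD(1)[OF rcos_disjoint[OF subR]] by (simp add: disjnt_def)
      moreover have "D \<noteq> {}"
        using that(3) subgroup.rcosets_non_empty[OF subK] by (simp add: cosets_within_def)
      ultimately show False using that(3,4) by (auto simp: cosets_within_def)
    qed
    then show "\<forall>C\<in>\<C>. \<forall>C'\<in>\<C>. C \<noteq> C' \<longrightarrow> cosets_within G K C \<inter> cosets_within G K C' = {}"
      by blast
  qed
  also have "\<dots> = card \<C> * card (cosets_within G K R)" using one by simp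
  finally show ?thesis .
qed

text \<open>This is the well-definedness behind the definite description. Two representations are
  compared through \<open>R \<inter> R'\<close>: refining to it multiplies numerator and denominator
  by the same index.\<close>

lemma basic_measure_Union:
  assumes R: "R \<lhd> G" "finite_index_subgroup G R" and \<C>: "\<C> \<subseteq> rcosets R"
  shows "basic_measure G (\<Union>\<C>) = real (card \<C>) / real (card (rcosets R))"
  unfolding basic_measure_def
proof (rule the_equality)
  show "\<exists>R' \<C>'. R' \<lhd> G \<and> finite_index_subgroup G R' \<and> \<C>' \<subseteq> rcosets R' \<and> \<Union>\<C> = \<Union>\<C>' \<and>
      real (card \<C>) / real (card (rcosets R)) = real (card \<C>') / real (card (rcosets R'))"
    using assms by blast
  fix x
  assume "\<exists>R' \<C>'. R' \<lhd> G \<and> finite_index_subgroup G R' \<and> \<C>' \<subseteq> rcosets R' \<and> \<Union>\<C> = \<Union>\<C>' \<and>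
      x = real (card \<C>') / real (card (rcosets R'))"
  then obtain R' \<C>' where R': "R' \<lhd> G" "finite_index_subgroup G R'"
    and \<C>': "\<C>' \<subseteq> rcosets R'" "\<Union>\<C> = \<Union>\<C>'" and x: "x = real (card \<C>') / real (card (rcosets R'))"
    by blast
  define K where "K = R \<inter> R'"
  have K: "finite_index_subgroup G K"
    unfolding K_def using R R' by (intro finite_index_subgroup_Int)
  \<comment> \<open>The right-hand side depends on the union of \<open>\<D>\<close> but no longer on
    \<open>Q\<close>.\<close>
  have ratio: "real (card \<D>) / real (card (rcosets Q)) =
      real (card (cosets_within G K (\<Union>\<D>))) / real (card (cosets_within G K (carrier G)))"
    if Q: "finite_index_subgroup G Q" "K \<subseteq> Q" "\<D> \<subseteq> rcosets Q" for Q \<D>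
  proof -
    have subK: "subgroup K G" and subQ: "subgroup Q G"
      using K Q by (auto simp: finite_index_subgroup_def)
    \<comment> \<open>This makes the index of \<open>K\<close> in \<open>Q\<close> nonzero, so that
      it can be cancelled.\<close>
    have "K \<in> cosets_within G K Q"
      using subgroup.subgroup_in_rcosets[OF subK is_group] Q by (simp add: cosets_within_def)
    then have "card (cosets_within G K Q) \<noteq> 0"
      using finite_cosets_within[OF K] by auto
    moreover have "card (cosets_within G K (carrier G)) =
        card (rcosets Q) * card (cosets_within G K Q)"
      using card_cosets_within_Union[OF K Q(1,2), of "rcosets Q"] rcosets_part_G[OF subQ] by simp
    ultimately show ?thesis
      using card_cosets_within_Union[OF K Q] by simp
  qed
  show "x = real (card \<C>) / real (card (rcosets R))"
    unfolding x using ratio[OF R(2) _ \<C>] ratio[OF R'(2) _ \<C>'(1)] \<C>'(2) by (simp add: K_def)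
qed

text \<open>Both measures have the index of \<open>R\<close> as denominator, so strict inequality
  means that some coset of \<open>R\<close> is missing from \<open>S\<close>.\<close>

lemma basic_measure_less_carrier_iff:
  assumes R: "R \<lhd> G" "finite_index_subgroup G R" and S: "coset_saturated G R S"
  shows "basic_measure G S < basic_measure G (carrier G) \<longleftrightarrow> S \<noteq> carrier G"
proof -
  have sub: "subgroup R G" and fin: "finite (rcosets R)"
    using R by (auto simp: finite_index_subgroup_def)
  have "rcosets R \<noteq> {}" using subgroup.subgroup_in_rcosets[OF sub is_group] by blast
  then have pos: "card (rcosets R) > 0" using fin by (simp add: card_gt_0_iff)
  have W: "cosets_within G R S \<subseteq> rcosets R" by (auto simp: cosets_within_def)
  have "basic_measure G S = real (card (cosets_within G R S)) / real (card (rcosets R))"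
    using basic_measure_Union[OF R W] Union_cosets_within[OF sub S] by simp
  moreover have "basic_measure G (carrier G) = 1"
    using basic_measure_Union[OF R order_refl] rcosets_part_G[OF sub] pos by simp
  ultimately have "basic_measure G S < basic_measure G (carrier G) \<longleftrightarrow>
      card (cosets_within G R S) < card (rcosets R)"
    using pos by simp
  also have "\<dots> \<longleftrightarrow> cosets_within G R S \<noteq> rcosets R"
    using W fin psubset_card_mono[of "rcosets R" "cosets_within G R S"] by auto
  also have "\<dots> \<longleftrightarrow> S \<noteq> carrier G"
  proof -
    have "cosets_within G R (carrier G) = rcosets R"
      using subgroup.rcosets_carrier[OF sub is_group] by (auto simp: cosets_within_def)
    then show ?thesis
      using Union_cosets_within[OF sub S] rcosets_part_G[OF sub] by metis
  qed
  finally show ?thesis .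
qed

section \<open>Powers of a saturated set\<close>

lemma set_power_subset_carrier:
  "A \<subseteq> carrier G \<Longrightarrow> set_power G A n \<subseteq> carrier G"
  by (induction n) (auto simp: set_power_0 set_power_Suc set_mult_def)

text \<open>The first factor of a product absorbs \<open>r\<close>. The zeroth power has no such
  factor: it is the set of the identity, in general not saturated.\<close>

lemma coset_saturated_set_power:
  assumes "R \<subseteq> carrier G" and A: "coset_saturated G R A" and "n \<ge> 1"
  shows "coset_saturated G R (set_power G A n)"
proof -
  have AG: "A \<subseteq> carrier G" using A by (simp add: coset_saturated_def)
  obtain m where n: "n = Suc m" using \<open>n \<ge> 1\<close> by (cases n) auto
  have "r \<otimes> (a \<otimes> s) = (r \<otimes> a) \<otimes> s" if "r \<in> R" "a \<in> A" "s \<in> set_power G A m" for r a s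
    using that assms(1) AG set_power_subset_carrier[OF AG] by (metis m_assoc subsetD)
  then show ?thesis
    using A set_power_subset_carrier[OF AG, of n] unfolding n
    by (fastforce simp: coset_saturated_def set_power_Suc set_mult_def)
qed

text \<open>Splits off the last factor, where \<open>set_power_Suc\<close> splits off the first;
  comparing left and right translates of a power needs both.\<close>

lemma set_power_Suc_right:
  assumes "A \<subseteq> carrier G"
  shows "set_power G A (Suc n) = set_power G A n <#> A"
proof (induction n)
  case 0
  show ?case using assms by (force simp: set_power_Suc set_power_0 set_mult_def)
next
  case (Suc n)
  then show ?case
    using assms set_power_subset_carrier[OF assms, of n]
    by (metis set_power_Suc set_mult_assoc)
qed

lemma set_power_nonempty: "A \<noteq> {} \<Longrightarrow> set_power G A n \<noteq> {}"
  by (induction n) (auto simp: set_power_0 set_power_Suc set_mult_def)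

section \<open>Powers of a subset of a left right coset\<close>

lemma left_right_coset_imp_power_ne:
  assumes H: "subgroup H G" "H \<noteq> carrier G" and "left_right_coset G H C" and A: "A \<subseteq> C"
  shows "set_power G A n \<noteq> carrier G"
proof -
  have HG: "H \<subseteq> carrier G" using H subgroup.subset by blast
  obtain g where g: "g \<in> carrier G" and C: "C = g <# H" "C = H #> g"
    using assms(3) by (auto simp: left_right_coset_def)
  have AG: "A \<subseteq> carrier G" using A C(2) g HG r_coset_subset_G by blast
  have sub: "set_power G A n \<subseteq> H #> (g [^] n)" for n
  proof (induction n)
    case 0
    then show ?case using H HG by (simp add: set_power_0 subgroup.one_closed)
  next
    case (Suc n)
    show ?case
    proof
      fix y assume "y \<in> set_power G A (Suc n)"
      then obtain s a where s: "s \<in> set_power G A n" and a: "a \<in> A" and y: "y = s \<otimes> a"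
        unfolding set_power_Suc_right[OF AG] by (auto simp: set_mult_def)
      obtain h where h: "h \<in> H" "s = h \<otimes> g [^] n" using s Suc by (auto simp: r_coset_def)
      \<comment> \<open>Powers of \<open>g\<close> inherit from \<open>g\<close> that their left and
        right cosets of \<open>H\<close> agree. This moves the factor \<open>k\<close> below from
        the right of \<open>g [^] Suc n\<close> to its left.\<close>
      have comm: "H #> (g [^] k) = g [^] k <# H" for k :: nat
      proof (induction k)
        case 0
        then show ?case using HG by (simp add: lcos_mult_one)
      next
        case (Suc k)
        have "H #> (g [^] Suc k) = (g [^] k <# H) #> g"
          using HG g Suc by (simp add: coset_mult_assoc[symmetric])
        also have "\<dots> = g [^] k <# (g <# H)"
          using HG g C coset_assoc[of "g [^] k" g H] by simp
        finally show ?case using HG g by (simp add: lcos_m_assoc)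
      qed
      have "a \<in> g <# H" using a A C by blast
      then obtain k where k: "k \<in> H" "a = g \<otimes> k" by (auto simp: l_coset_def)
      have "y = h \<otimes> (g [^] Suc n \<otimes> k)"
        using h k y g HG by (simp add: subset_iff m_assoc)
      moreover have "g [^] Suc n \<otimes> k \<in> H #> (g [^] Suc n)"
        using k unfolding comm[of "Suc n"] by (auto simp: l_coset_def)
      then obtain l where l: "l \<in> H" "g [^] Suc n \<otimes> k = l \<otimes> g [^] Suc n"
        by (auto simp: r_coset_def)
      ultimately have "y = (h \<otimes> l) \<otimes> g [^] Suc n"
        using h l g HG nat_pow_closed[OF g, of "Suc n"] by (simp add: subset_iff m_assoc del: nat_pow_Suc)
      then show "y \<in> H #> (g [^] Suc n)"
        using h l subgroup.m_closed[OF H(1)] by (auto simp: r_coset_def)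
    qed
  qed
  \<comment> \<open>The coset of \<open>g [^] n\<close> misses the product of \<open>g [^] n\<close>
    with any element outside \<open>H\<close>.\<close>
  obtain x where x: "x \<in> carrier G" "x \<notin> H" using H HG by blast
  have "x \<otimes> g [^] n \<notin> H #> (g [^] n)"
    using x g HG by (auto simp: r_coset_def subset_iff)
  moreover have "x \<otimes> g [^] n \<in> carrier G" using x g by simp
  ultimately show ?thesis using sub[of n] by blast
qed

section \<open>Stabilisers under left translation\<close>

text \<open>Left and right translations commute, and right translation by \<open>b\<close> can be
  undone.\<close>

lemma l_coset_r_coset_eq_iff:
  assumes "S \<subseteq> carrier G" "x \<in> carrier G" "b \<in> carrier G"
  shows "x <# (S #> b) = S #> b \<longleftrightarrow> x <# S = S"
proof
  have xS: "x <# S \<subseteq> carrier G" using assms l_coset_subset_G by blast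
  have assoc: "x <# (S #> b) = (x <# S) #> b" using assms by (simp add: coset_assoc)
  {
    assume "x <# (S #> b) = S #> b"
    then have "(x <# S) #> b #> inv b = S #> b #> inv b" using assoc by simp
    then show "x <# S = S" using assms xS by (simp add: coset_mult_assoc)
  next
    assume "x <# S = S"
    then show "x <# (S #> b) = S #> b" using assoc by simp
  }
qed

text \<open>Serves two purposes: \<open>c = b\<close> shows that the stabiliser of
  \<open>b <# S\<close> is a conjugate of that of \<open>S\<close>, and \<open>x = \<one>\<close>
  tells when two translates of \<open>S\<close> coincide.\<close>

lemma l_coset_l_coset_eq_iff:
  assumes "S \<subseteq> carrier G" "x \<in> carrier G" "b \<in> carrier G" "c \<in> carrier G"
  shows "x <# (b <# S) = c <# S \<longleftrightarrow> (inv c \<otimes> x \<otimes> b) <# S = S"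
proof
  assume "x <# (b <# S) = c <# S"
  then have "inv c <# (x <# (b <# S)) = inv c <# (c <# S)" by simp
  then show "(inv c \<otimes> x \<otimes> b) <# S = S"
    using assms by (simp add: lcos_m_assoc lcos_mult_one m_assoc)
next
  assume "(inv c \<otimes> x \<otimes> b) <# S = S"
  then have "c <# ((inv c \<otimes> x \<otimes> b) <# S) = c <# S" by simp
  moreover have "c \<otimes> (inv c \<otimes> x \<otimes> b) = x \<otimes> b" using assms by (simp add: m_assoc[symmetric])
  ultimately show "x <# (b <# S) = c <# S"
    using assms by (simp add: lcos_m_assoc)
qed

lemma subgroup_l_stabiliser:
  assumes "S \<subseteq> carrier G"
  shows "subgroup {x \<in> carrier G. x <# S = S} G"
proof (rule subgroupI)
  have "\<one> \<in> {x \<in> carrier G. x <# S = S}" using assms by (simp add: lcos_mult_one)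
  then show "{x \<in> carrier G. x <# S = S} \<noteq> {}" by blast
  \<comment> \<open>The instance used reads: \<open>S = a <# S\<close> iff \<open>inv a\<close>
    stabilises \<open>S\<close>.\<close>
  show "inv a \<in> {x \<in> carrier G. x <# S = S}" if "a \<in> {x \<in> carrier G. x <# S = S}" for a
    using that assms l_coset_l_coset_eq_iff[of S \<one> \<one> a] by (simp add: lcos_mult_one)
  show "a \<otimes> b \<in> {x \<in> carrier G. x <# S = S}"
    if "a \<in> {x \<in> carrier G. x <# S = S}" "b \<in> {x \<in> carrier G. x <# S = S}" for a b
    using that assms by (simp add: lcos_m_assoc[symmetric])
qed auto

text \<open>The cosets inside \<open>S\<close> are among those inside \<open>T\<close>, and finite
  counting makes the two families equal, so \<open>S\<close> contains their union \<open>T\<close>.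
  Saturation is asked of \<open>T\<close> alone, so that \<open>S\<close> may be any
  translate.\<close>

lemma coset_saturated_eqI:
  assumes R: "finite_index_subgroup G R" and T: "coset_saturated G R T"
    and "S \<subseteq> T" and "card (cosets_within G R T) \<le> card (cosets_within G R S)"
  shows "S = T"
proof -
  have "cosets_within G R S = cosets_within G R T"
    using assms by (intro card_seteq finite_cosets_within) (auto simp: cosets_within_def)
  then have "\<Union>(cosets_within G R S) = T"
    using Union_cosets_within[OF _ T] R by (simp add: finite_index_subgroup_def)
  then have "T \<subseteq> S" by (auto simp: cosets_within_def)
  then show ?thesis using assms(3) by blast
qed

section \<open>From proper powers to a left right coset\<close>

lemma power_ne_imp_left_right_coset:
  assumes R: "R \<lhd> G" "finite_index_subgroup G R" and A: "coset_saturated G R A" "A \<noteq> {}"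
    and ne: "\<And>n. n \<ge> 1 \<Longrightarrow> set_power G A n \<noteq> carrier G"
  obtains H C where "finite_index_subgroup G H" and "H \<noteq> carrier G"
    and "left_right_coset G H C" and "A \<subseteq> C"
proof -
  have AG: "A \<subseteq> carrier G" using A by (simp add: coset_saturated_def)
  have sub: "subgroup R G" and fin: "finite (rcosets R)"
    using R by (auto simp: finite_index_subgroup_def)
  have RG: "R \<subseteq> carrier G" using sub subgroup.subset by blast
  define N where "N n = card (cosets_within G R (set_power G A n))" for n
  have bound: "N n \<le> card (rcosets R)" for n
    unfolding N_def using fin by (intro card_mono) (auto simp: cosets_within_def)
  \<comment> \<open>The counts are bounded by the index of \<open>R\<close>, so a maximum exists.
    The range starts at 1 because the powers must be saturated.\<close>
  have "\<exists>n\<ge>1. \<forall>k\<ge>1. N k \<le> N n"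
    using ex_has_greatest_nat[of "\<lambda>n. n \<ge> 1" 1 N "card (rcosets R) + 1"] bound
    by (metis less_add_one order_le_less_trans order_refl)
  then obtain n where n: "n \<ge> 1" and max: "N (Suc n) \<le> N n" by auto
  define S where "S = set_power G A n"
  define T where "T = set_power G A (Suc n)"
  have SG: "S \<subseteq> carrier G" unfolding S_def by (rule set_power_subset_carrier[OF AG])
  have S: "coset_saturated G R S" and T: "coset_saturated G R T"
    unfolding S_def T_def using coset_saturated_set_power[OF RG A(1)] n by auto
  \<comment> \<open>The translate lies in \<open>T\<close> and has at least as many cosets as
    \<open>S\<close>, which by maximality has at least as many as \<open>T\<close>.\<close>
  have left: "b <# S = T" if "b \<in> A" for b
  proof (rule coset_saturated_eqI[OF R(2) T])
    show "b <# S \<subseteq> T" using that by (auto simp: S_def T_def set_power_Suc set_mult_def l_coset_def)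
    show "card (cosets_within G R T) \<le> card (cosets_within G R (b <# S))"
      using max card_cosets_within_l_coset[OF R(2,1), of b S] that AG
      by (auto simp: N_def S_def T_def)
  qed
  have right: "S #> b = T" if "b \<in> A" for b
  proof (rule coset_saturated_eqI[OF R(2) T])
    show "S #> b \<subseteq> T"
      using that by (auto simp: S_def T_def set_power_Suc_right[OF AG] set_mult_def r_coset_def)
    show "card (cosets_within G R T) \<le> card (cosets_within G R (S #> b))"
      using max card_cosets_within_r_coset[OF R(2), of b S] that AG
      by (auto simp: N_def S_def T_def)
  qed
  define H where "H = {x \<in> carrier G. x <# S = S}"
  have H: "subgroup H G" unfolding H_def by (rule subgroup_l_stabiliser[OF SG])
  have HG: "H \<subseteq> carrier G" using H subgroup.subset by blast
  \<comment> \<open>Saturation gives only \<open>r <# S \<subseteq> S\<close>; the reverse inclusion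
    comes from applying it to \<open>inv r\<close>.\<close>
  have "R \<subseteq> H"
  proof
    fix r assume r: "r \<in> R"
    have sat: "q <# S \<subseteq> S" if "q \<in> R" for q
      using S that by (auto simp: coset_saturated_def l_coset_def)
    have "r \<in> carrier G" "inv r \<in> R" using r RG subgroup.m_inv_closed[OF sub] by auto
    then have "r <# (inv r <# S) = S" using SG by (simp add: lcos_m_assoc lcos_mult_one)
    moreover have "r <# (inv r <# S) \<subseteq> r <# S"
      using sat[OF \<open>inv r \<in> R\<close>] by (auto simp: l_coset_def)
    ultimately show "r \<in> H"
      using sat[OF r] \<open>r \<in> carrier G\<close> by (auto simp: H_def)
  qed
  then have fi: "finite_index_subgroup G H"
    using finite_index_subgroup_mono[OF R(2) H] by blast
  \<comment> \<open>Left translations carry a point \<open>s\<close> of \<open>S\<close> to every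
    element of the group, so a set stable under all of them is everything.\<close>
  have proper: "H \<noteq> carrier G"
  proof
    assume HC: "H = carrier G"
    obtain s where s: "s \<in> S" using set_power_nonempty[OF A(2)] unfolding S_def by blast
    have "y \<in> S" if y: "y \<in> carrier G" for y
    proof -
      have "y \<otimes> inv s \<in> H" using HC y s SG by auto
      then have "(y \<otimes> inv s) <# S = S" by (simp add: H_def)
      then have "(y \<otimes> inv s) \<otimes> s \<in> S" using s unfolding l_coset_def by blast
      then show ?thesis using y s SG by (simp add: subset_iff m_assoc)
    qed
    then show False using ne[OF n] SG unfolding S_def by blast
  qed
  obtain a where a: "a \<in> A" using A(2) by blast
  have aG: "a \<in> carrier G" using a AG by blast
  \<comment> \<open>The set \<open>T\<close> is both \<open>S #> a\<close> and
    \<open>a <# S\<close>. The first form gives it the stabiliser \<open>H\<close>, the second the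
    conjugate of \<open>H\<close> by \<open>a\<close>; hence \<open>a\<close> normalises
    \<open>H\<close>.\<close>
  have stab_T: "x \<in> H \<longleftrightarrow> x <# T = T" if "x \<in> carrier G" for x
    using l_coset_r_coset_eq_iff[OF SG that aG] right[OF a] that by (simp add: H_def)
  have conj: "x \<in> H \<longleftrightarrow> inv a \<otimes> x \<otimes> a \<in> H" if x: "x \<in> carrier G" for x
    using stab_T[OF x] l_coset_l_coset_eq_iff[OF SG x aG aG] left[OF a] x aG by (simp add: H_def)
  have "a <# H = H #> a"
  proof (intro equalityI subsetI)
    fix y assume "y \<in> a <# H"
    then obtain h where h: "h \<in> H" "y = a \<otimes> h" by (auto simp: l_coset_def)
    then have hG: "h \<in> carrier G" using HG by blast
    have "inv a \<otimes> (a \<otimes> h \<otimes> inv a) \<otimes> a = h" using aG hG by (simp add: m_assoc inv_solve_left')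
    then have "a \<otimes> h \<otimes> inv a \<in> H" using conj[of "a \<otimes> h \<otimes> inv a"] h aG hG by simp
    moreover have "y = (a \<otimes> h \<otimes> inv a) \<otimes> a" using h aG hG by (simp add: m_assoc)
    ultimately show "y \<in> H #> a" by (auto simp: r_coset_def)
  next
    fix y assume "y \<in> H #> a"
    then obtain h where h: "h \<in> H" "y = h \<otimes> a" by (auto simp: r_coset_def)
    then have hG: "h \<in> carrier G" using HG by blast
    have "inv a \<otimes> h \<otimes> a \<in> H" using conj[OF hG] h by simp
    moreover have "y = a \<otimes> (inv a \<otimes> h \<otimes> a)" using h aG hG by (simp add: m_assoc[symmetric])
    ultimately show "y \<in> a <# H" by (auto simp: l_coset_def)
  qed
  then have "left_right_coset G H (a <# H)" using aG by (auto simp: left_right_coset_def)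
  moreover have "A \<subseteq> a <# H"
  proof
    fix b assume b: "b \<in> A"
    then have bG: "b \<in> carrier G" using AG by blast
    \<comment> \<open>Both translates equal \<open>T\<close>; the factor \<open>\<one>\<close> fits
      this to \<open>l_coset_l_coset_eq_iff\<close>.\<close>
    have "\<one> <# (b <# S) = a <# S"
      using left[OF a] left[OF b] lcos_m_assoc[OF SG one_closed bG] bG by simp
    then have "inv a \<otimes> b \<in> H"
      using l_coset_l_coset_eq_iff[OF SG one_closed bG aG] aG bG by (simp add: H_def)
    moreover have "b = a \<otimes> (inv a \<otimes> b)" using aG bG by (simp add: m_assoc[symmetric])
    ultimately show "b \<in> a <# H" by (auto simp: l_coset_def)
  qed
  ultimately show ?thesis using that fi proper by blast
qed

end

theorem corollary3p9:
  fixes G :: "('a, 'b) monoid_scheme" and A :: "'a set"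
  assumes "group G"
    and "A \<in> basic_sets G"
    and "A \<noteq> {}"
  shows "(\<forall>n::nat. n \<ge> 1 \<longrightarrow> basic_measure G (set_power G A n) < basic_measure G (carrier G))
    \<longleftrightarrow> (\<exists>H C. finite_index_subgroup G H \<and> H \<noteq> carrier G \<and> left_right_coset G H C \<and> A \<subseteq> C)"
proof -
  interpret group G by (fact assms(1))
  obtain R where R: "R \<lhd> G" "finite_index_subgroup G R" and A: "coset_saturated G R A"
    using basic_sets_saturated[OF assms(2)] .
  have "R \<subseteq> carrier G" using R(1) normal_imp_subgroup subgroup.subset by blast
  \<comment> \<open>From here on the measure is gone: each inequality says that a power is not the
    whole group.\<close>
  then have iff: "basic_measure G (set_power G A n) < basic_measure G (carrier G) \<longleftrightarrow>
      set_power G A n \<noteq> carrier G" if "n \<ge> 1" for n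
    using basic_measure_less_carrier_iff[OF R] coset_saturated_set_power[OF _ A that] by blast
  show ?thesis
  proof
    assume "\<forall>n::nat. n \<ge> 1 \<longrightarrow> basic_measure G (set_power G A n) < basic_measure G (carrier G)"
    then show "\<exists>H C. finite_index_subgroup G H \<and> H \<noteq> carrier G \<and> left_right_coset G H C \<and> A \<subseteq> C"
      using power_ne_imp_left_right_coset[OF R A assms(3)] iff by metis
  next
    assume "\<exists>H C. finite_index_subgroup G H \<and> H \<noteq> carrier G \<and> left_right_coset G H C \<and> A \<subseteq> C"
    then show "\<forall>n::nat. n \<ge> 1 \<longrightarrow>
        basic_measure G (set_power G A n) < basic_measure G (carrier G)"
      using left_right_coset_imp_power_ne iff by (metis finite_index_subgroup_def)
  qed
qed

end
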